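(* The logic $\mathbf{IL}^-(\mathbf{J2}_+, \mathbf{J5})$ has the Craig interpolation property: for any formulas $A$ and $B$, if $\mathbf{IL}^-(\mathbf{J2}_+, \mathbf{J5}) \vdash A \to B$, then there exists a formula $C$ such that $v(C)\subseteq v(A)\cap v(B)$, $\mathbf{IL}^-(\mathbf{J2}_+, \mathbf{J5}) \vdash A \to C$ and $\mathbf{IL}^-(\mathbf{J2}_+, \mathbf{J5}) \vdash C \to B$.
   Context: Formulas are generated by $A ::= \bot \mid p \mid A \to A \mid \Box A \mid A \rhd A$, where $p$ ranges over a countably infinite set of propositional variables. The symbols $\neg,\land,\lor,\leftrightarrow,\top,\Diamond$ (with $\Diamond A := \neg\Box\neg A$) are the usual abbreviations. $\neg,\Box,\Diamond$ bind most strongly. $v(A)$ is the set of propositional variables contained in $A$. The logic $\mathbf{IL}^-$ has as axioms all instances of: $\mathbf{L1}$: all tautologies in this language; $\mathbf{L2}$: $\Box(A\to B)\to(\Box A\to\Box B)$; $\mathbf{L3}$: $\Box(\Box A\to A)\to\Box A$; $\mathbf{J3}$: $((A\rhd C)\land(B\rhd C))\to((A\lor B)\rhd C)$; $\mathbf{J6}$: $\Box A\leftrightarrow((\neg A)\rhd\bot)$. Its inference rules are Modus Ponens, Necessitation (from $A$ infer $\Box A$), $\mathbf{R1}$ (from $A\to B$ infer $(C\rhd A)\to(C\rhd B)$) and $\mathbf{R2}$ (from $A\to B$ infer $(B\rhd C)\to(A\rhd C)$). $\mathbf{IL}^-(\Sigma_1,\ldots,\Sigma_n)$ is the logic obtained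 from $\mathbf{IL}^-$ by adding the schemata $\Sigma_1,\ldots,\Sigma_n$ as axiom schemata (with the same rules). $\mathbf{J2}_+$ is the schema $((A\rhd(B\lor C))\land(B\rhd C))\to(A\rhd C)$ and $\mathbf{J5}$ is the schema $\Diamond A\rhd A$. $L\vdash A$ means that $A$ is a theorem of $L$. *)

theory Defs
  imports Main
begin

datatype fm =
    Bot  ("\<^bold>\<bottom>")
  | Var nat
  | Imp fm fm  (infixr "\<^bold>\<longrightarrow>" 55)
  | Box fm  ("\<^bold>\<box> _" [80] 80)
  | Rhd fm fm  (infix "\<^bold>\<rhd>" 60)

abbreviation Neg :: "fm \<Rightarrow> fm"  ("\<^bold>\<not> _" [80] 80)
  where "\<^bold>\<not> A \<equiv> A \<^bold>\<longrightarrow> \<^bold>\<bottom>"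

abbreviation Disj :: "fm \<Rightarrow> fm \<Rightarrow> fm"  (infixr "\<^bold>\<or>" 65)
  where "A \<^bold>\<or> B \<equiv> \<^bold>\<not> A \<^bold>\<longrightarrow> B"

abbreviation Conj :: "fm \<Rightarrow> fm \<Rightarrow> fm"  (infixr "\<^bold>\<and>" 70)
  where "A \<^bold>\<and> B \<equiv> \<^bold>\<not> (A \<^bold>\<longrightarrow> \<^bold>\<not> B)"

abbreviation Iff :: "fm \<Rightarrow> fm \<Rightarrow> fm"  (infix "\<^bold>\<longleftrightarrow>" 50)
  where "A \<^bold>\<longleftrightarrow> B \<equiv> (A \<^bold>\<longrightarrow> B) \<^bold>\<and> (B \<^bold>\<longrightarrow> A)"

abbreviation Dia :: "fm \<Rightarrow> fm"  ("\<^bold>\<diamond> _" [80] 80)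
  where "\<^bold>\<diamond> A \<equiv> \<^bold>\<not> \<^bold>\<box> \<^bold>\<not> A"

primrec vars :: "fm \<Rightarrow> nat set" where
  "vars \<^bold>\<bottom> = {}"
| "vars (Var p) = {p}"
| "vars (A \<^bold>\<longrightarrow> B) = vars A \<union> vars B"
| "vars (\<^bold>\<box> A) = vars A"
| "vars (A \<^bold>\<rhd> B) = vars A \<union> vars B"

text \<open>Truth-functional evaluation: variables and formulas whose main connective is modal
  are treated as atoms, whose truth values are given by \<open>e\<close>.\<close>

primrec tval :: "(fm \<Rightarrow> bool) \<Rightarrow> fm \<Rightarrow> bool" where
  "tval e \<^bold>\<bottom> = False"
| "tval e (Var p) = e (Var p)"
| "tval e (A \<^bold>\<longrightarrow> B) = (tval e A \<longrightarrow> tval e B)"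
| "tval e (\<^bold>\<box> A) = e (\<^bold>\<box> A)"
| "tval e (A \<^bold>\<rhd> B) = e (A \<^bold>\<rhd> B)"

definition tautology :: "fm \<Rightarrow> bool"
  where "tautology A \<longleftrightarrow> (\<forall>e. tval e A)"

text \<open>\<open>ILm \<Sigma>\<close> is provability in the logic obtained from \<open>IL\<^sup>-\<close> by adding the formulas in \<open>\<Sigma>\<close>
  as axioms; an axiom schema is represented by the set of all its instances.\<close>

inductive ILm :: "fm set \<Rightarrow> fm \<Rightarrow> bool" for \<Sigma> :: "fm set" where
  L1: "tautology A \<Longrightarrow> ILm \<Sigma> A"
| L2: "ILm \<Sigma> (\<^bold>\<box> (A \<^bold>\<longrightarrow> B) \<^bold>\<longrightarrow> (\<^bold>\<box> A \<^bold>\<longrightarrow> \<^bold>\<box> B))"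
| L3: "ILm \<Sigma> (\<^bold>\<box> (\<^bold>\<box> A \<^bold>\<longrightarrow> A) \<^bold>\<longrightarrow> \<^bold>\<box> A)"
| J3: "ILm \<Sigma> (((A \<^bold>\<rhd> C) \<^bold>\<and> (B \<^bold>\<rhd> C)) \<^bold>\<longrightarrow> ((A \<^bold>\<or> B) \<^bold>\<rhd> C))"
| J6: "ILm \<Sigma> ((\<^bold>\<box> A) \<^bold>\<longleftrightarrow> ((\<^bold>\<not> A) \<^bold>\<rhd> \<^bold>\<bottom>))"
| extra: "A \<in> \<Sigma> \<Longrightarrow> ILm \<Sigma> A"
| MP: "ILm \<Sigma> (A \<^bold>\<longrightarrow> B) \<Longrightarrow> ILm \<Sigma> A \<Longrightarrow> ILm \<Sigma> B"
| Nec: "ILm \<Sigma> A \<Longrightarrow> ILm \<Sigma> (\<^bold>\<box> A)"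
| R1: "ILm \<Sigma> (A \<^bold>\<longrightarrow> B) \<Longrightarrow> ILm \<Sigma> ((C \<^bold>\<rhd> A) \<^bold>\<longrightarrow> (C \<^bold>\<rhd> B))"
| R2: "ILm \<Sigma> (A \<^bold>\<longrightarrow> B) \<Longrightarrow> ILm \<Sigma> ((B \<^bold>\<rhd> C) \<^bold>\<longrightarrow> (A \<^bold>\<rhd> C))"

definition J2_plus :: "fm set"
  where "J2_plus = {((A \<^bold>\<rhd> (B \<^bold>\<or> C)) \<^bold>\<and> (B \<^bold>\<rhd> C)) \<^bold>\<longrightarrow> (A \<^bold>\<rhd> C) | A B C. True}"

definition J5 :: "fm set"
  where "J5 = {(\<^bold>\<diamond> A) \<^bold>\<rhd> A | A. True}"

end

theory Submission
  imports Defs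
begin

text \<open>If \<open>A \<^bold>\<longrightarrow> B\<close> has no interpolant, then the pair of theories \<open>({A}, {\<^bold>\<not> B})\<close> cannot be separated by a
  formula in the common variables. Every inseparable pair has a Veltman-style model in which \<open>S\<^sub>x\<close> is a
  transitive relation on the successors of \<open>x\<close> that contains the accessibility relation but need not be
  reflexive; soundness for such models then contradicts the provability of \<open>A \<^bold>\<longrightarrow> B\<close>. To
  refute \<open>C \<^bold>\<rhd> D\<close> at \<open>x\<close> one needs a class of inseparable successors avoiding \<open>D\<close>. Starting from
  nothing, one collects those \<open>F\<close> with \<open>F \<^bold>\<rhd> G\<close> true at \<open>x\<close> for which \<open>G\<close> cannot be
  realized without meeting \<open>D\<close> or an already collected formula; each failure yields a separating formula,
  and if \<open>C\<close> itself fails in the end, a conjunction of formulas \<open>J \<^bold>\<rhd> I\<close> built from these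
  separates the pair at \<open>x\<close>.\<close>

abbreviation pr :: "fm \<Rightarrow> bool"
  where "pr \<equiv> ILm (J2_plus \<union> J5)"

subsection \<open>Derivability from a set of formulas\<close>

inductive dv :: "fm set \<Rightarrow> fm \<Rightarrow> bool" for \<Gamma> :: "fm set" where
  hyp: "A \<in> \<Gamma> \<Longrightarrow> dv \<Gamma> A"
| base: "pr A \<Longrightarrow> dv \<Gamma> A"
| mp: "dv \<Gamma> (A \<^bold>\<longrightarrow> B) \<Longrightarrow> dv \<Gamma> A \<Longrightarrow> dv \<Gamma> B"

lemma dv_taut: "tautology A \<Longrightarrow> dv \<Gamma> A"
  by (intro dv.base ILm.L1)

lemma dv_taut1: "dv \<Gamma> A \<Longrightarrow> tautology (A \<^bold>\<longrightarrow> B) \<Longrightarrow> dv \<Gamma> B"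
  by (meson dv.mp dv_taut)

lemma dv_taut2: "dv \<Gamma> A \<Longrightarrow> dv \<Gamma> B \<Longrightarrow> tautology (A \<^bold>\<longrightarrow> B \<^bold>\<longrightarrow> C) \<Longrightarrow> dv \<Gamma> C"
  by (meson dv.mp dv_taut)

lemma dv_conj: "dv \<Gamma> A \<Longrightarrow> dv \<Gamma> B \<Longrightarrow> dv \<Gamma> (A \<^bold>\<and> B)"
  by (erule (1) dv_taut2) (simp add: tautology_def)

lemma dv_cut: "dv \<Delta> A \<Longrightarrow> (\<And>B. B \<in> \<Delta> \<Longrightarrow> dv \<Gamma> B) \<Longrightarrow> dv \<Gamma> A"
  by (induction rule: dv.induct) (blast intro: dv.intros)+

lemma dv_mono: "dv \<Delta> A \<Longrightarrow> \<Delta> \<subseteq> \<Gamma> \<Longrightarrow> dv \<Gamma> A"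
  by (erule dv_cut) (blast intro: dv.hyp)

lemma dv_empty: "dv {} A \<Longrightarrow> pr A"
  by (induction rule: dv.induct) (auto intro: ILm.MP)

lemma dv_insert_iff: "dv (insert A \<Gamma>) B \<longleftrightarrow> dv \<Gamma> (A \<^bold>\<longrightarrow> B)"
proof
  assume "dv (insert A \<Gamma>) B"
  then show "dv \<Gamma> (A \<^bold>\<longrightarrow> B)"
  proof induction
    case (hyp X)
    show ?case
    proof (cases "X = A")
      case True
      then show ?thesis by (intro dv_taut) (simp add: tautology_def)
    next
      case False
      with hyp have "dv \<Gamma> X" by (auto intro: dv.hyp)
      then show ?thesis by (rule dv_taut1) (simp add: tautology_def)
    qed
  next
    case (base X)
    then have "dv \<Gamma> X" by (rule dv.base)
    then show ?case by (rule dv_taut1) (simp add: tautology_def)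
  next
    case (mp X Y)
    from mp.IH show ?case by (rule dv_taut2) (simp add: tautology_def)
  qed
next
  assume "dv \<Gamma> (A \<^bold>\<longrightarrow> B)"
  then have "dv (insert A \<Gamma>) (A \<^bold>\<longrightarrow> B)" by (rule dv_mono) blast
  then show "dv (insert A \<Gamma>) B" by (rule dv.mp) (simp add: dv.hyp)
qed

lemma dv_K: "dv \<Gamma> (\<^bold>\<box> (A \<^bold>\<longrightarrow> B)) \<Longrightarrow> dv \<Gamma> (\<^bold>\<box> A) \<Longrightarrow> dv \<Gamma> (\<^bold>\<box> B)"
  by (meson dv.mp dv.base ILm.L2)

lemma dv_box: "dv \<Delta> A \<Longrightarrow> (\<And>B. B \<in> \<Delta> \<Longrightarrow> dv \<Gamma> (\<^bold>\<box> B)) \<Longrightarrow> dv \<Gamma> (\<^bold>\<box> A)"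
  by (induction rule: dv.induct) (auto intro: dv.base ILm.Nec dv_K)

lemma dv_box_taut: "dv \<Gamma> (\<^bold>\<box> A) \<Longrightarrow> tautology (A \<^bold>\<longrightarrow> B) \<Longrightarrow> dv \<Gamma> (\<^bold>\<box> B)"
  by (rule dv_K[where A = A]) (auto intro: dv.base ILm.Nec ILm.L1)

lemma dv_4:
  assumes "dv \<Gamma> (\<^bold>\<box> A)"
  shows "dv \<Gamma> (\<^bold>\<box> \<^bold>\<box> A)"
proof -
  let ?B = "A \<^bold>\<and> \<^bold>\<box> A"
  have "dv {\<^bold>\<box> ?B} (\<^bold>\<box> ?B)" by (simp add: dv.hyp)
  then have "dv {\<^bold>\<box> ?B} (\<^bold>\<box> A)" by (rule dv_box_taut) (simp add: tautology_def)
  then have "dv {} (\<^bold>\<box> ?B \<^bold>\<longrightarrow> \<^bold>\<box> A)" by (simp add: dv_insert_iff)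
  then have "dv {} (A \<^bold>\<longrightarrow> (\<^bold>\<box> ?B \<^bold>\<longrightarrow> ?B))"
    by (rule dv_taut1) (simp add: tautology_def)
  then have "dv {A} (\<^bold>\<box> ?B \<^bold>\<longrightarrow> ?B)" by (simp add: dv_insert_iff)
  then have "dv \<Gamma> (\<^bold>\<box> (\<^bold>\<box> ?B \<^bold>\<longrightarrow> ?B))" by (rule dv_box) (simp add: assms)
  then have "dv \<Gamma> (\<^bold>\<box> ?B)" by (meson dv.mp dv.base ILm.L3)
  then show ?thesis by (rule dv_box_taut) (simp add: tautology_def)
qed

subsection \<open>Derived principles for the binary modality\<close>

lemma dv_J2:
  assumes "dv \<Gamma> (A \<^bold>\<rhd> (B \<^bold>\<or> C))" "dv \<Gamma> (B \<^bold>\<rhd> C)"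
  shows "dv \<Gamma> (A \<^bold>\<rhd> C)"
proof -
  have "dv \<Gamma> (((A \<^bold>\<rhd> (B \<^bold>\<or> C)) \<^bold>\<and> (B \<^bold>\<rhd> C)) \<^bold>\<longrightarrow> (A \<^bold>\<rhd> C))"
    by (intro dv.base ILm.extra) (auto simp: J2_plus_def)
  then show ?thesis using dv_conj[OF assms] by (rule dv.mp)
qed

lemma dv_J3: "dv \<Gamma> (A \<^bold>\<rhd> C) \<Longrightarrow> dv \<Gamma> (B \<^bold>\<rhd> C) \<Longrightarrow> dv \<Gamma> ((A \<^bold>\<or> B) \<^bold>\<rhd> C)"
  by (meson dv.mp dv.base dv_conj ILm.J3)

lemma dv_J5: "dv \<Gamma> ((\<^bold>\<diamond> A) \<^bold>\<rhd> A)"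
  by (intro dv.base ILm.extra) (auto simp: J5_def)

lemma dv_J6: "dv \<Gamma> (\<^bold>\<box> A) \<longleftrightarrow> dv \<Gamma> ((\<^bold>\<not> A) \<^bold>\<rhd> \<^bold>\<bottom>)"
proof -
  have "dv \<Gamma> ((\<^bold>\<box> A) \<^bold>\<longleftrightarrow> ((\<^bold>\<not> A) \<^bold>\<rhd> \<^bold>\<bottom>))" by (intro dv.base ILm.J6)
  then have "dv \<Gamma> ((\<^bold>\<box> A) \<^bold>\<longrightarrow> ((\<^bold>\<not> A) \<^bold>\<rhd> \<^bold>\<bottom>))" "dv \<Gamma> (((\<^bold>\<not> A) \<^bold>\<rhd> \<^bold>\<bottom>) \<^bold>\<longrightarrow> (\<^bold>\<box> A))"
    by (auto elim!: dv_taut1 simp: tautology_def)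
  then show ?thesis by (blast intro: dv.mp)
qed

lemma dv_R1: "dv \<Gamma> (C \<^bold>\<rhd> A) \<Longrightarrow> tautology (A \<^bold>\<longrightarrow> B) \<Longrightarrow> dv \<Gamma> (C \<^bold>\<rhd> B)"
  by (meson dv.mp dv.base ILm.R1 ILm.L1)

lemma dv_R2: "dv \<Gamma> (B \<^bold>\<rhd> C) \<Longrightarrow> tautology (A \<^bold>\<longrightarrow> B) \<Longrightarrow> dv \<Gamma> (A \<^bold>\<rhd> C)"
  by (meson dv.mp dv.base ILm.R2 ILm.L1)

lemma rhd_right:
  assumes "dv \<Gamma> (\<^bold>\<box> (A \<^bold>\<longrightarrow> B))" "dv \<Gamma> (C \<^bold>\<rhd> A)"
  shows "dv \<Gamma> (C \<^bold>\<rhd> B)"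
proof (rule dv_J2)
  show "dv \<Gamma> (C \<^bold>\<rhd> (\<^bold>\<not> (A \<^bold>\<longrightarrow> B) \<^bold>\<or> B))"
    using assms(2) by (rule dv_R1) (simp add: tautology_def)
  show "dv \<Gamma> (\<^bold>\<not> (A \<^bold>\<longrightarrow> B) \<^bold>\<rhd> B)"
    using assms(1)[unfolded dv_J6] by (rule dv_R1) (simp add: tautology_def)
qed

lemma rhd_left:
  assumes "dv \<Gamma> (\<^bold>\<box> (A \<^bold>\<longrightarrow> B))" "dv \<Gamma> (B \<^bold>\<rhd> C)"
  shows "dv \<Gamma> (A \<^bold>\<rhd> C)"
proof -
  have "dv \<Gamma> (\<^bold>\<not> (A \<^bold>\<longrightarrow> B) \<^bold>\<rhd> C)"
    using assms(1)[unfolded dv_J6] by (rule dv_R1) (simp add: tautology_def)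
  then have "dv \<Gamma> ((\<^bold>\<not> (A \<^bold>\<longrightarrow> B) \<^bold>\<or> B) \<^bold>\<rhd> C)" using assms(2) by (rule dv_J3)
  then show ?thesis by (rule dv_R2) (simp add: tautology_def)
qed

lemma rhd_dia:
  assumes "dv \<Gamma> (A \<^bold>\<rhd> B)"
  shows "dv \<Gamma> ((\<^bold>\<diamond> A) \<^bold>\<rhd> B)"
proof (rule dv_J2)
  show "dv \<Gamma> ((\<^bold>\<diamond> A) \<^bold>\<rhd> (A \<^bold>\<or> B))"
    using dv_J5 by (rule dv_R1) (simp add: tautology_def)
qed (rule assms)

lemma rhd_Bot: "dv \<Gamma> (\<^bold>\<bottom> \<^bold>\<rhd> A)"
proof -
  have "dv \<Gamma> (\<^bold>\<box> \<^bold>\<not> \<^bold>\<bottom>)" by (intro dv.base ILm.Nec ILm.L1) (simp add: tautology_def)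
  then have "dv \<Gamma> (\<^bold>\<not> \<^bold>\<not> \<^bold>\<bottom> \<^bold>\<rhd> A)"
    unfolding dv_J6 by (rule dv_R1) (simp add: tautology_def)
  then show ?thesis by (rule dv_R2) (simp add: tautology_def)
qed

text \<open>By Loeb's principle a satisfiable formula is satisfiable at a world above which it fails.\<close>

abbreviation last_sat :: "fm \<Rightarrow> fm"
  where "last_sat A \<equiv> A \<^bold>\<and> \<^bold>\<box> \<^bold>\<not> A"

lemma box_last_sat: "dv \<Gamma> (\<^bold>\<box> (A \<^bold>\<longrightarrow> \<^bold>\<diamond> last_sat A \<^bold>\<or> last_sat A))"
proof -
  have "dv {\<^bold>\<box> \<^bold>\<not> last_sat A} (\<^bold>\<box> \<^bold>\<not> last_sat A)" by (simp add: dv.hyp)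
  then have "dv {\<^bold>\<box> \<^bold>\<not> last_sat A} (\<^bold>\<box> (\<^bold>\<box> \<^bold>\<not> A \<^bold>\<longrightarrow> \<^bold>\<not> A))"
    by (rule dv_box_taut) (auto simp add: tautology_def)
  then have "dv {\<^bold>\<box> \<^bold>\<not> last_sat A} (\<^bold>\<box> \<^bold>\<not> A)" by (meson dv.mp dv.base ILm.L3)
  then have "dv {} (\<^bold>\<box> \<^bold>\<not> last_sat A \<^bold>\<longrightarrow> \<^bold>\<box> \<^bold>\<not> A)" by (simp add: dv_insert_iff)
  then have "dv {} (A \<^bold>\<longrightarrow> \<^bold>\<diamond> last_sat A \<^bold>\<or> last_sat A)"
    by (rule dv_taut1) (simp add: tautology_def)
  then show ?thesis by (rule dv_box) simp
qed

lemma rhd_last_sat_left: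
  assumes "dv \<Gamma> (last_sat A \<^bold>\<rhd> B)"
  shows "dv \<Gamma> (A \<^bold>\<rhd> B)"
  using box_last_sat by (rule rhd_left) (intro dv_J3 rhd_dia assms)

lemma rhd_last_sat_right:
  assumes "dv \<Gamma> (B \<^bold>\<rhd> A)"
  shows "dv \<Gamma> (B \<^bold>\<rhd> last_sat A)"
  by (rule dv_J2[OF rhd_right[OF box_last_sat assms] dv_J5])

fun poss :: "fm list \<Rightarrow> fm" where
  "poss [] = \<^bold>\<bottom>"
| "poss (A # L) = (A \<^bold>\<or> \<^bold>\<diamond> A) \<^bold>\<or> poss L"

definition never :: "fm list \<Rightarrow> fm set"
  where "never L = (\<Union>A \<in> set L. {\<^bold>\<not> A, \<^bold>\<box> \<^bold>\<not> A})"

lemma rhd_poss: "(\<And>A. A \<in> set L \<Longrightarrow> dv \<Gamma> (A \<^bold>\<rhd> B)) \<Longrightarrow> dv \<Gamma> (poss L \<^bold>\<rhd> B)"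
  by (induction L) (auto simp: rhd_Bot intro!: dv_J3 rhd_dia)

lemma taut_poss_snoc:
  "tautology (poss (L @ [A]) \<^bold>\<longrightarrow> (poss L \<^bold>\<or> \<^bold>\<diamond> A) \<^bold>\<or> A)"
  by (induction L) (auto simp: tautology_def)

text \<open>\<open>D \<^bold>\<rhd> D\<close> is not available in this logic, so \<open>D\<close> itself is kept on the right.\<close>

lemma rhd_poss_snoc:
  assumes "\<And>A. A \<in> set L \<Longrightarrow> dv \<Gamma> (A \<^bold>\<rhd> D)" "dv \<Gamma> (B \<^bold>\<rhd> poss (L @ [D]))"
  shows "dv \<Gamma> (B \<^bold>\<rhd> D)"
proof (rule dv_J2)
  show "dv \<Gamma> (B \<^bold>\<rhd> ((poss L \<^bold>\<or> \<^bold>\<diamond> D) \<^bold>\<or> D))"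
    using assms(2) taut_poss_snoc by (rule dv_R1)
  show "dv \<Gamma> ((poss L \<^bold>\<or> \<^bold>\<diamond> D) \<^bold>\<rhd> D)"
    using assms(1) by (intro dv_J3 rhd_poss dv_J5)
qed

lemma taut_never: "B \<in> never L \<Longrightarrow> tautology (\<^bold>\<not> poss L \<^bold>\<longrightarrow> B)"
  by (induction L) (auto simp: tautology_def never_def)

lemma dv_never:
  assumes "dv (\<Gamma> \<union> never L) A"
  shows "dv \<Gamma> (poss L \<^bold>\<or> A)"
proof -
  have "dv (insert (\<^bold>\<not> poss L) \<Gamma>) A"
    using assms
  proof (rule dv_cut)
    fix B assume "B \<in> \<Gamma> \<union> never L"
    then show "dv (insert (\<^bold>\<not> poss L) \<Gamma>) B"
      by (auto intro: dv.hyp dv_taut1[OF dv.hyp taut_never])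
  qed
  then show ?thesis by (simp add: dv_insert_iff)
qed

definition unbox :: "fm set \<Rightarrow> fm set"
  where "unbox \<Gamma> = {A. dv \<Gamma> (\<^bold>\<box> A)}"

lemma dv_unbox: "dv (unbox \<Gamma>) A \<Longrightarrow> dv \<Gamma> (\<^bold>\<box> A)"
  by (erule dv_box) (simp add: unbox_def)

lemma dv_unbox_never: "dv (unbox \<Gamma> \<union> never L) A \<Longrightarrow> dv \<Gamma> (\<^bold>\<box> (poss L \<^bold>\<or> A))"
  by (intro dv_unbox dv_never)

lemma dv_unbox_never_insert:
  assumes "dv (insert A (unbox \<Gamma> \<union> never L)) B"
  shows "dv \<Gamma> (\<^bold>\<box> (A \<^bold>\<longrightarrow> poss L \<^bold>\<or> B))"
proof -
  have "dv (unbox \<Gamma> \<union> never L) (A \<^bold>\<longrightarrow> B)" using assms by (simp add: dv_insert_iff)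
  then have "dv \<Gamma> (\<^bold>\<box> (poss L \<^bold>\<or> (A \<^bold>\<longrightarrow> B)))" by (rule dv_unbox_never)
  then show ?thesis by (rule dv_box_taut) (simp add: tautology_def)
qed

subsection \<open>Separation\<close>

text \<open>\<open>L1\<close> and \<open>L2\<close> collect the left-hand sides \<open>F\<close> of formulas \<open>F \<^bold>\<rhd> G\<close> whose \<open>G\<close> has been found not
  to be realizable when \<open>D\<close> and the formulas collected so far are to be avoided. In the joint theory
  every such \<open>F\<close> interprets \<open>D\<close>; \<open>\<theta>\<close> and \<open>I\<close> are the partial interpolants that witness this.\<close>

definition avoid :: "nat set \<Rightarrow> fm set \<Rightarrow> fm set \<Rightarrow> fm \<Rightarrow> fm list \<Rightarrow> fm list \<Rightarrow> bool"
  where "avoid V \<Gamma>1 \<Gamma>2 D L1 L2 \<longleftrightarrow> (\<exists>\<theta> I. vars \<theta> \<subseteq> V \<and> vars I \<subseteq> V \<and> dv \<Gamma>2 \<theta>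
    \<and> (\<forall>F \<in> set L2. dv \<Gamma>2 (F \<^bold>\<rhd> I))
    \<and> (\<forall>F \<in> set L1. dv (insert \<theta> \<Gamma>1) (F \<^bold>\<rhd> D))
    \<and> dv \<Gamma>1 (\<^bold>\<box> (I \<^bold>\<longrightarrow> poss (L1 @ [D]))))"

lemma avoid_Nil: "avoid V \<Gamma>1 \<Gamma>2 D [] []"
proof -
  have "dv \<Gamma>1 (\<^bold>\<box> (\<^bold>\<bottom> \<^bold>\<longrightarrow> poss ([] @ [D])))" "dv \<Gamma>2 (\<^bold>\<not> \<^bold>\<bottom>)"
    by (intro dv.base ILm.Nec ILm.L1, simp add: tautology_def)+
  then show ?thesis
    unfolding avoid_def by (intro exI[of _ "\<^bold>\<not> \<^bold>\<bottom>"] exI[of _ "\<^bold>\<bottom>"]) simp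
qed

lemma avoid_extract:
  assumes "avoid V \<Gamma>1 \<Gamma>2 D L1 L2"
    and J: "vars J \<subseteq> V" "dv (unbox \<Gamma>2 \<union> never L2) (\<^bold>\<not> J)"
  obtains \<theta> I where "vars \<theta> \<subseteq> V" "vars I \<subseteq> V" "dv \<Gamma>2 \<theta>"
    "\<forall>F \<in> set L2. dv \<Gamma>2 (F \<^bold>\<rhd> I)"
    "dv \<Gamma>1 (\<^bold>\<box> (I \<^bold>\<longrightarrow> poss (L1 @ [D])))"
    "\<forall>F \<in> set L1. dv (insert \<theta> \<Gamma>1) (F \<^bold>\<rhd> D)"
    "dv (insert \<theta> \<Gamma>1) (J \<^bold>\<rhd> poss (L1 @ [D]))"
proof -
  obtain \<theta> I where I: "vars \<theta> \<subseteq> V" "vars I \<subseteq> V" "dv \<Gamma>2 \<theta>"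
    "\<forall>F \<in> set L2. dv \<Gamma>2 (F \<^bold>\<rhd> I)" "\<forall>F \<in> set L1. dv (insert \<theta> \<Gamma>1) (F \<^bold>\<rhd> D)"
    "dv \<Gamma>1 (\<^bold>\<box> (I \<^bold>\<longrightarrow> poss (L1 @ [D])))"
    using assms(1) unfolding avoid_def by blast
  have "dv \<Gamma>2 (\<^bold>\<box> (J \<^bold>\<longrightarrow> poss L2))"
    using dv_unbox_never[OF J(2)] by (rule dv_box_taut) (auto simp: tautology_def)
  then have JI: "dv \<Gamma>2 (J \<^bold>\<rhd> I)"
    by (rule rhd_left[OF _ rhd_poss]) (use I(4) in blast)
  let ?\<theta> = "\<theta> \<^bold>\<and> (J \<^bold>\<rhd> I)"
  have \<theta>: "dv (insert ?\<theta> \<Gamma>1) A" if "dv (insert \<theta> \<Gamma>1) A" for A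
  proof -
    have "dv \<Gamma>1 (\<theta> \<^bold>\<longrightarrow> A)" using that by (simp add: dv_insert_iff)
    then have "dv \<Gamma>1 (?\<theta> \<^bold>\<longrightarrow> A)" by (rule dv_taut1) (simp add: tautology_def)
    then show ?thesis by (simp add: dv_insert_iff)
  qed
  have "dv (insert ?\<theta> \<Gamma>1) ?\<theta>" by (simp add: dv.hyp)
  then have "dv (insert ?\<theta> \<Gamma>1) (J \<^bold>\<rhd> I)" by (rule dv_taut1) (simp add: tautology_def)
  moreover have "dv (insert ?\<theta> \<Gamma>1) (\<^bold>\<box> (I \<^bold>\<longrightarrow> poss (L1 @ [D])))"
    using I(6) by (rule dv_mono) blast
  ultimately have "dv (insert ?\<theta> \<Gamma>1) (J \<^bold>\<rhd> poss (L1 @ [D]))"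
    by (rule rhd_right[rotated])
  moreover have "\<forall>F \<in> set L1. dv (insert ?\<theta> \<Gamma>1) (F \<^bold>\<rhd> D)"
    using I(5) by (blast intro: \<theta>)
  moreover have "dv \<Gamma>2 ?\<theta>" using I(3) JI by (rule dv_conj)
  moreover have "vars ?\<theta> \<subseteq> V" using I(1,2) J(1) by simp
  ultimately show thesis using I(2,4,6) by (intro that[of ?\<theta> I])
qed

lemma avoid_Cons_left:
  assumes "avoid V \<Gamma>1 \<Gamma>2 D L1 L2" "dv \<Gamma>1 (F \<^bold>\<rhd> G)"
    and J: "vars J \<subseteq> V" "dv (unbox \<Gamma>2 \<union> never L2) (\<^bold>\<not> J)"
      "dv (insert (last_sat G) (unbox \<Gamma>1 \<union> never (L1 @ [D]))) J"
  shows "avoid V \<Gamma>1 \<Gamma>2 D (F # L1) L2"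
proof -
  obtain \<theta> I where I: "vars \<theta> \<subseteq> V" "vars I \<subseteq> V" "dv \<Gamma>2 \<theta>"
    "\<forall>F \<in> set L2. dv \<Gamma>2 (F \<^bold>\<rhd> I)"
    "dv \<Gamma>1 (\<^bold>\<box> (I \<^bold>\<longrightarrow> poss (L1 @ [D])))"
    "\<forall>F \<in> set L1. dv (insert \<theta> \<Gamma>1) (F \<^bold>\<rhd> D)"
    "dv (insert \<theta> \<Gamma>1) (J \<^bold>\<rhd> poss (L1 @ [D]))"
    using avoid_extract[OF assms(1) J(1,2)] .
  have "dv \<Gamma>1 (F \<^bold>\<rhd> (poss (L1 @ [D]) \<^bold>\<or> J))"
    using dv_unbox_never_insert[OF J(3)] rhd_last_sat_right[OF assms(2)] by (rule rhd_right)
  then have "dv (insert \<theta> \<Gamma>1) (F \<^bold>\<rhd> (poss (L1 @ [D]) \<^bold>\<or> J))" by (rule dv_mono) blast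
  then have "dv (insert \<theta> \<Gamma>1) (F \<^bold>\<rhd> (J \<^bold>\<or> poss (L1 @ [D])))"
    by (rule dv_R1) (auto simp: tautology_def)
  then have "dv (insert \<theta> \<Gamma>1) (F \<^bold>\<rhd> poss (L1 @ [D]))"
    using I(7) by (rule dv_J2)
  then have "dv (insert \<theta> \<Gamma>1) (F \<^bold>\<rhd> D)"
    by (rule rhd_poss_snoc[rotated]) (use I(6) in blast)
  moreover have "dv \<Gamma>1 (\<^bold>\<box> (I \<^bold>\<longrightarrow> poss ((F # L1) @ [D])))"
    using I(5) by (rule dv_box_taut) (simp add: tautology_def)
  ultimately show ?thesis
    unfolding avoid_def using I by (intro exI[of _ \<theta>] exI[of _ I]) auto
qed

lemma avoid_Cons_right:
  assumes "avoid V \<Gamma>1 \<Gamma>2 D L1 L2" "dv \<Gamma>2 (F \<^bold>\<rhd> G)"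
    and J: "vars J \<subseteq> V" "dv (unbox \<Gamma>1 \<union> never (L1 @ [D])) (\<^bold>\<not> J)"
      "dv (insert (last_sat G) (unbox \<Gamma>2 \<union> never L2)) J"
  shows "avoid V \<Gamma>1 \<Gamma>2 D L1 (F # L2)"
proof -
  obtain \<theta> I where I: "vars \<theta> \<subseteq> V" "vars I \<subseteq> V" "dv \<Gamma>2 \<theta>"
    "\<forall>F \<in> set L2. dv \<Gamma>2 (F \<^bold>\<rhd> I)" "\<forall>F \<in> set L1. dv (insert \<theta> \<Gamma>1) (F \<^bold>\<rhd> D)"
    "dv \<Gamma>1 (\<^bold>\<box> (I \<^bold>\<longrightarrow> poss (L1 @ [D])))"
    using assms(1) unfolding avoid_def by blast
  have L2: "dv \<Gamma>2 (E \<^bold>\<rhd> (I \<^bold>\<or> J))" if "E \<in> set L2" for E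
    using I(4)[rule_format, OF that] by (rule dv_R1) (simp add: tautology_def)
  have "dv \<Gamma>2 (F \<^bold>\<rhd> (poss L2 \<^bold>\<or> J))"
    using dv_unbox_never_insert[OF J(3)] rhd_last_sat_right[OF assms(2)] by (rule rhd_right)
  then have "dv \<Gamma>2 (F \<^bold>\<rhd> (poss L2 \<^bold>\<or> (I \<^bold>\<or> J)))"
    by (rule dv_R1) (simp add: tautology_def)
  then have F: "dv \<Gamma>2 (F \<^bold>\<rhd> (I \<^bold>\<or> J))"
    using rhd_poss[OF L2] by (rule dv_J2)
  have "dv \<Gamma>1 (\<^bold>\<box> ((I \<^bold>\<longrightarrow> poss (L1 @ [D])) \<^bold>\<longrightarrow> (I \<^bold>\<or> J \<^bold>\<longrightarrow> poss (L1 @ [D]))))"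
    using dv_unbox_never[OF J(2)] by (rule dv_box_taut) (auto simp: tautology_def)
  then have "dv \<Gamma>1 (\<^bold>\<box> (I \<^bold>\<or> J \<^bold>\<longrightarrow> poss (L1 @ [D])))" using I(6) by (rule dv_K)
  with I(1-3,5) J(1) L2 F show ?thesis
    unfolding avoid_def by (intro exI[of _ \<theta>] exI[of _ "I \<^bold>\<or> J"]) auto
qed

lemma avoid_separable:
  assumes "avoid V \<Gamma>1 \<Gamma>2 D L1 L2" "dv \<Gamma>1 (\<^bold>\<not> (C \<^bold>\<rhd> D))"
    and J: "vars J \<subseteq> V" "dv (unbox \<Gamma>2 \<union> never L2) (\<^bold>\<not> J)"
      "dv (insert (last_sat C \<^bold>\<and> \<^bold>\<box> \<^bold>\<not> D) (unbox \<Gamma>1 \<union> never L1)) J"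
  shows "\<exists>I. vars I \<subseteq> V \<and> dv \<Gamma>1 (\<^bold>\<not> I) \<and> dv \<Gamma>2 I"
proof -
  obtain \<theta> where \<theta>: "vars \<theta> \<subseteq> V" "dv \<Gamma>2 \<theta>"
    and L1: "\<forall>F \<in> set L1. dv (insert \<theta> \<Gamma>1) (F \<^bold>\<rhd> D)"
    and "dv (insert \<theta> \<Gamma>1) (J \<^bold>\<rhd> poss (L1 @ [D]))"
    using avoid_extract[OF assms(1) J(1,2)] .
  then have "dv (insert \<theta> \<Gamma>1) (J \<^bold>\<rhd> D)" by (blast intro: rhd_poss_snoc)
  then have *: "dv (insert \<theta> \<Gamma>1) ((poss L1 \<^bold>\<or> J \<^bold>\<or> \<^bold>\<diamond> D) \<^bold>\<rhd> D)"
    using L1 by (intro dv_J3 rhd_poss dv_J5) auto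
  have "dv \<Gamma>1 (\<^bold>\<box> (last_sat C \<^bold>\<longrightarrow> poss L1 \<^bold>\<or> J \<^bold>\<or> \<^bold>\<diamond> D))"
    using dv_unbox_never_insert[OF J(3)] by (rule dv_box_taut) (auto simp: tautology_def)
  then have "dv (insert \<theta> \<Gamma>1) (\<^bold>\<box> (last_sat C \<^bold>\<longrightarrow> poss L1 \<^bold>\<or> J \<^bold>\<or> \<^bold>\<diamond> D))"
    by (rule dv_mono) blast
  then have "dv (insert \<theta> \<Gamma>1) (C \<^bold>\<rhd> D)"
    by (rule rhd_last_sat_left[OF rhd_left[OF _ *]])
  then have "dv \<Gamma>1 (\<theta> \<^bold>\<longrightarrow> C \<^bold>\<rhd> D)" by (simp add: dv_insert_iff)
  then have "dv \<Gamma>1 (\<^bold>\<not> \<theta>)"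
    using assms(2) by (rule dv_taut2) (auto simp: tautology_def)
  with \<theta> show ?thesis by blast
qed

text \<open>The two sides of a pair of theories are indexed by \<open>bool\<close>, so that the sides can be swapped by negation.\<close>

definition insep :: "nat set \<Rightarrow> (bool \<Rightarrow> fm set) \<Rightarrow> bool"
  where "insep V \<Gamma> \<longleftrightarrow> \<not> (\<exists>I. vars I \<subseteq> V \<and> dv (\<Gamma> True) I \<and> dv (\<Gamma> False) (\<^bold>\<not> I))"

lemma not_insepE:
  assumes "\<not> insep V \<Gamma>"
  obtains I where "vars I \<subseteq> V" "dv (\<Gamma> s) I" "dv (\<Gamma> (\<not> s)) (\<^bold>\<not> I)"
proof -
  obtain I where I: "vars I \<subseteq> V" "dv (\<Gamma> True) I" "dv (\<Gamma> False) (\<^bold>\<not> I)"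
    using assms unfolding insep_def by blast
  have "dv (\<Gamma> True) (\<^bold>\<not> \<^bold>\<not> I)"
    using I(2) by (rule dv_taut1) (simp add: tautology_def)
  then show thesis using I that[of I] that[of "\<^bold>\<not> I"] by (cases s) auto
qed

lemma insepD:
  assumes "insep V \<Gamma>" "vars I \<subseteq> V" "dv (\<Gamma> s) I" "dv (\<Gamma> (\<not> s)) (\<^bold>\<not> I)"
  shows False
proof (cases s)
  case True
  then show ?thesis using assms unfolding insep_def by auto
next
  case False
  have "dv (\<Gamma> s) (\<^bold>\<not> \<^bold>\<not> I)"
    using assms(3) by (rule dv_taut1) (simp add: tautology_def)
  moreover have "vars (\<^bold>\<not> I) \<subseteq> V" using assms(2) by simp
  ultimately show ?thesis
    using False assms(1,4) unfolding insep_def by fastforce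
qed

lemma insep_consistent:
  assumes "insep V \<Gamma>" "dv (\<Gamma> s) A" "dv (\<Gamma> s) (\<^bold>\<not> A)"
  shows False
proof -
  have "dv (\<Gamma> s) \<^bold>\<bottom>" by (rule dv.mp[OF assms(3,2)])
  moreover have "dv (\<Gamma> (\<not> s)) (\<^bold>\<not> \<^bold>\<bottom>)" by (rule dv_taut) (simp add: tautology_def)
  ultimately show False using insepD[OF assms(1), of "\<^bold>\<bottom>"] by simp
qed

lemma insep_insert:
  assumes "insep V \<Gamma>"
  shows "insep V (\<Gamma>(s := insert A (\<Gamma> s))) \<or> insep V (\<Gamma>(s := insert (\<^bold>\<not> A) (\<Gamma> s)))"
proof (rule ccontr)
  assume *: "\<not> ?thesis"
  obtain I where I: "vars I \<subseteq> V" "dv (\<Gamma> s) (A \<^bold>\<longrightarrow> I)" "dv (\<Gamma> (\<not> s)) (\<^bold>\<not> I)"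
    by (rule not_insepE[where \<Gamma> = "\<Gamma>(s := insert A (\<Gamma> s))" and V = V and s = s])
      (use * in \<open>auto simp: dv_insert_iff\<close>)
  obtain J where J: "vars J \<subseteq> V" "dv (\<Gamma> s) (\<^bold>\<not> A \<^bold>\<longrightarrow> J)" "dv (\<Gamma> (\<not> s)) (\<^bold>\<not> J)"
    by (rule not_insepE[where \<Gamma> = "\<Gamma>(s := insert (\<^bold>\<not> A) (\<Gamma> s))" and V = V and s = s])
      (use * in \<open>auto simp: dv_insert_iff\<close>)
  have "dv (\<Gamma> s) (I \<^bold>\<or> J)"
    using I(2) J(2) by (rule dv_taut2) (auto simp: tautology_def)
  moreover have "dv (\<Gamma> (\<not> s)) (\<^bold>\<not> (I \<^bold>\<or> J))"
    using I(3) J(3) by (rule dv_taut2) (simp add: tautology_def)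
  ultimately show False using insepD[OF assms, of "I \<^bold>\<or> J"] I(1) J(1) by simp
qed

lemma insep_extend:
  assumes "finite P" "insep V \<Gamma>"
  shows "\<exists>\<Delta>. insep V \<Delta> \<and> (\<forall>s. \<Gamma> s \<subseteq> \<Delta> s) \<and> (\<forall>(s, A) \<in> P. A \<in> \<Delta> s \<or> \<^bold>\<not> A \<in> \<Delta> s)"
  using assms
proof (induction P arbitrary: \<Gamma>)
  case empty
  then show ?case by auto
next
  case (insert p P)
  obtain s A where p: "p = (s, A)" by force
  obtain B where B: "B \<in> {A, \<^bold>\<not> A}" "insep V (\<Gamma>(s := insert B (\<Gamma> s)))"
    using insep_insert[OF insert.prems] by blast
  obtain \<Delta> where \<Delta>: "insep V \<Delta>" "\<forall>t. (\<Gamma>(s := insert B (\<Gamma> s))) t \<subseteq> \<Delta> t"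
    "\<forall>(t, A) \<in> P. A \<in> \<Delta> t \<or> \<^bold>\<not> A \<in> \<Delta> t"
    using insert.IH[OF B(2)] by blast
  have "\<Gamma> t \<subseteq> \<Delta> t" for t using \<Delta>(2)[rule_format, of t] by (auto split: if_splits)
  moreover have "B \<in> \<Delta> s" using \<Delta>(2)[rule_format, of s] by simp
  ultimately show ?case using \<Delta>(1,3) B(1) p by (intro exI[of _ \<Delta>]) auto
qed

subsection \<open>Semantics\<close>

primrec holds :: "('w \<Rightarrow> nat \<Rightarrow> bool) \<Rightarrow> ('w \<Rightarrow> 'w \<Rightarrow> bool) \<Rightarrow> ('w \<Rightarrow> 'w \<Rightarrow> 'w \<Rightarrow> bool) \<Rightarrow> 'w \<Rightarrow> fm \<Rightarrow> bool"
  where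
  "holds v R S x \<^bold>\<bottom> \<longleftrightarrow> False"
| "holds v R S x (Var p) \<longleftrightarrow> v x p"
| "holds v R S x (A \<^bold>\<longrightarrow> B) \<longleftrightarrow> (holds v R S x A \<longrightarrow> holds v R S x B)"
| "holds v R S x (\<^bold>\<box> A) \<longleftrightarrow> (\<forall>y. R x y \<longrightarrow> holds v R S y A)"
| "holds v R S x (A \<^bold>\<rhd> B) \<longleftrightarrow>
    (\<forall>y. R x y \<longrightarrow> holds v R S y A \<longrightarrow> (\<exists>z. S x y z \<and> holds v R S z B))"

lemma tval_holds: "tval (holds v R S x) A \<longleftrightarrow> holds v R S x A"
  by (induction A) auto

lemma soundness:
  assumes "pr A"
    and trans: "\<And>x y z. R x y \<Longrightarrow> R y z \<Longrightarrow> R x z"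
    and wf: "wfP (\<lambda>y x. R x y)"
    and S: "\<And>x y z. S x y z \<Longrightarrow> R x z"
      "\<And>x y z w. S x y z \<Longrightarrow> S x z w \<Longrightarrow> S x y w"
      "\<And>x y z. R x y \<Longrightarrow> R y z \<Longrightarrow> S x y z"
  shows "holds v R S x A"
  using assms(1)
proof (induction arbitrary: x)
  case (L1 A)
  then show ?case unfolding tautology_def by (simp flip: tval_holds)
next
  case (L3 A)
  have "holds v R S y A" if "R x y" "holds v R S x (\<^bold>\<box> (\<^bold>\<box> A \<^bold>\<longrightarrow> A))" for y
    using wf that
  proof (induction y rule: wfp_induct_rule)
    case (less y)
    then have "holds v R S y (\<^bold>\<box> A)" using trans unfolding holds.simps(4) by blast
    with less.prems show ?case by simp
  qed
  then show ?case by simp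
next
  case (extra A)
  then consider B C D where "A = ((B \<^bold>\<rhd> (C \<^bold>\<or> D)) \<^bold>\<and> (C \<^bold>\<rhd> D)) \<^bold>\<longrightarrow> (B \<^bold>\<rhd> D)"
    | B where "A = (\<^bold>\<diamond> B) \<^bold>\<rhd> B"
    unfolding J2_plus_def J5_def by blast
  then show ?case
  proof cases
    case 1
    have "\<exists>z. S x y z \<and> holds v R S z D"
      if BCD: "holds v R S x (B \<^bold>\<rhd> (C \<^bold>\<or> D))" "holds v R S x (C \<^bold>\<rhd> D)"
        and y: "R x y" "holds v R S y B" for y
    proof -
      obtain z where z: "S x y z" "holds v R S z (C \<^bold>\<or> D)"
        using BCD(1) y unfolding holds.simps(5) by blast
      show ?thesis
      proof (cases "holds v R S z D")
        case True
        with z(1) show ?thesis by blast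
      next
        case False
        then have "holds v R S z C" using z(2) by simp
        then obtain w where "S x z w" "holds v R S w D"
          using BCD(2) S(1)[OF z(1)] unfolding holds.simps(5) by blast
        with S(2)[OF z(1)] show ?thesis by blast
      qed
    qed
    then show ?thesis unfolding 1 by simp
  next
    case 2
    have "\<exists>z. S x y z \<and> holds v R S z B" if "R x y" "holds v R S y (\<^bold>\<diamond> B)" for y
      using that S(3) by simp blast
    then show ?thesis unfolding 2 by simp
  qed
next
  case (J3 A C B)
  show ?case by simp blast
next
  case (R1 A B C)
  then show ?case by simp blast
qed auto

fun subs :: "fm \<Rightarrow> fm set" where
  "subs \<^bold>\<bottom> = {\<^bold>\<bottom>}"
| "subs (Var p) = {Var p}"
| "subs (A \<^bold>\<longrightarrow> B) = insert (A \<^bold>\<longrightarrow> B) (subs A \<union> subs B)"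
| "subs (\<^bold>\<box> A) = insert (\<^bold>\<box> A) (subs A)"
| "subs (A \<^bold>\<rhd> B) = insert (A \<^bold>\<rhd> B) (subs A \<union> subs B)"

lemma subs_refl: "A \<in> subs A"
  by (cases A) auto

lemma finite_subs: "finite (subs A)"
  by (induction A) auto

lemma subs_trans: "B \<in> subs A \<Longrightarrow> subs B \<subseteq> subs A"
  by (induction A) auto

lemma vars_subs: "B \<in> subs A \<Longrightarrow> vars B \<subseteq> vars A"
  by (induction A) auto

subsection \<open>Models of inseparable pairs\<close>

locale interpolation =
  fixes V :: "nat set" and \<Phi> :: "bool \<Rightarrow> fm set"
  assumes finite_\<Phi>: "finite (\<Phi> s)"
    and subs_\<Phi>: "A \<in> \<Phi> s \<Longrightarrow> subs A \<subseteq> \<Phi> s"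
    and common: "Var p \<in> \<Phi> True \<Longrightarrow> Var p \<in> \<Phi> False \<Longrightarrow> p \<in> V"
begin

lemma \<Phi>_Imp: "A \<^bold>\<longrightarrow> B \<in> \<Phi> s \<Longrightarrow> A \<in> \<Phi> s \<and> B \<in> \<Phi> s"
  and \<Phi>_Box: "\<^bold>\<box> A \<in> \<Phi> s \<Longrightarrow> A \<in> \<Phi> s"
  and \<Phi>_Rhd: "A \<^bold>\<rhd> B \<in> \<Phi> s \<Longrightarrow> A \<in> \<Phi> s \<and> B \<in> \<Phi> s"
  by (auto dest!: subs_\<Phi> simp: subs_refl subset_iff)

definition full :: "(bool \<Rightarrow> fm set) \<Rightarrow> bool"
  where "full \<Gamma> \<longleftrightarrow> insep V \<Gamma> \<and> (\<forall>s. \<forall>A \<in> \<Phi> s. dv (\<Gamma> s) A \<or> dv (\<Gamma> s) (\<^bold>\<not> A))"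

lemma full_Neg_iff: "full \<Gamma> \<Longrightarrow> A \<in> \<Phi> s \<Longrightarrow> dv (\<Gamma> s) (\<^bold>\<not> A) \<longleftrightarrow> \<not> dv (\<Gamma> s) A"
  unfolding full_def using insep_consistent by blast

lemma full_extend:
  assumes "insep V \<Gamma>"
  shows "\<exists>\<Delta>. full \<Delta> \<and> (\<forall>s. \<Gamma> s \<subseteq> \<Delta> s)"
proof -
  have "finite (Sigma UNIV \<Phi>)" by (intro finite_SigmaI finite_\<Phi>) simp
  then obtain \<Delta> where "insep V \<Delta>" "\<forall>s. \<Gamma> s \<subseteq> \<Delta> s"
    "\<forall>(s, A) \<in> Sigma UNIV \<Phi>. A \<in> \<Delta> s \<or> \<^bold>\<not> A \<in> \<Delta> s"
    using insep_extend[OF _ assms] by blast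
  then show ?thesis unfolding full_def by (blast intro: dv.hyp)
qed

definition goals :: "bool \<Rightarrow> fm set"
  where "goals s = Neg ` (\<Phi> s \<union> Neg ` \<Phi> s)"

definition above :: "(bool \<Rightarrow> fm set) \<Rightarrow> (bool \<Rightarrow> fm set) \<Rightarrow> bool"
  where "above \<Gamma> \<Delta> \<longleftrightarrow> (\<forall>s A. dv (\<Gamma> s) (\<^bold>\<box> A) \<longrightarrow> dv (\<Delta> s) A)
    \<and> (\<exists>s. \<exists>A \<in> goals s. dv (\<Delta> s) (\<^bold>\<box> A) \<and> \<not> dv (\<Gamma> s) (\<^bold>\<box> A))"

lemma above_box: "above \<Gamma> \<Delta> \<Longrightarrow> dv (\<Gamma> s) (\<^bold>\<box> A) \<Longrightarrow> dv (\<Delta> s) (\<^bold>\<box> A)"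
  unfolding above_def using dv_4 by blast

lemma above_trans: "above \<Gamma> \<Delta> \<Longrightarrow> above \<Delta> \<Theta> \<Longrightarrow> above \<Gamma> \<Theta>"
  using above_box[of \<Gamma> \<Delta>] above_box[of \<Delta> \<Theta>] unfolding above_def by meson

definition rank :: "(bool \<Rightarrow> fm set) \<Rightarrow> nat"
  where "rank \<Gamma> = (\<Sum>s\<in>UNIV. card {A \<in> goals s. \<not> dv (\<Gamma> s) (\<^bold>\<box> A)})"

lemma above_rank:
  assumes "above \<Gamma> \<Delta>"
  shows "rank \<Delta> < rank \<Gamma>"
  unfolding rank_def
proof (rule sum_strict_mono_ex1)
  have fin: "finite {A \<in> goals s. \<not> dv (\<Gamma> s) (\<^bold>\<box> A)}" for s
    unfolding goals_def using finite_\<Phi> by simp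
  have sub: "{A \<in> goals s. \<not> dv (\<Delta> s) (\<^bold>\<box> A)} \<subseteq> {A \<in> goals s. \<not> dv (\<Gamma> s) (\<^bold>\<box> A)}" for s
    using above_box[OF assms] by blast
  show "\<forall>s\<in>UNIV. card {A \<in> goals s. \<not> dv (\<Delta> s) (\<^bold>\<box> A)} \<le> card {A \<in> goals s. \<not> dv (\<Gamma> s) (\<^bold>\<box> A)}"
    using card_mono[OF fin sub] by simp
  obtain s A where "A \<in> goals s" "dv (\<Delta> s) (\<^bold>\<box> A)" "\<not> dv (\<Gamma> s) (\<^bold>\<box> A)"
    using assms unfolding above_def by blast
  then have "{A \<in> goals s. \<not> dv (\<Delta> s) (\<^bold>\<box> A)} \<subset> {A \<in> goals s. \<not> dv (\<Gamma> s) (\<^bold>\<box> A)}"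
    using sub[of s] by blast
  then show "\<exists>s\<in>UNIV. card {A \<in> goals s. \<not> dv (\<Delta> s) (\<^bold>\<box> A)} < card {A \<in> goals s. \<not> dv (\<Gamma> s) (\<^bold>\<box> A)}"
    using psubset_card_mono[OF fin] by blast
qed simp

text \<open>The successors of a world come in classes \<open>(K, s, D)\<close>. A class refutes a formula \<open>C \<^bold>\<rhd> D\<close> of side \<open>s\<close>:
  its entry (\<open>e = True\<close>) satisfies \<open>C\<close> and possibly \<open>D\<close>, while no other world of the class satisfies \<open>D\<close>.
  A formula \<open>F \<^bold>\<rhd> G\<close> true at the world is respected because \<open>F\<close> fails throughout the class or \<open>G\<close> is
  realized in the class outside the entry.\<close>

definition succ :: "(bool \<Rightarrow> fm set) \<Rightarrow> (bool \<Rightarrow> fm set) \<Rightarrow> bool \<Rightarrow> fm \<Rightarrow> bool \<Rightarrow> (bool \<Rightarrow> fm set) \<Rightarrow> bool"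
  where "succ \<Gamma> K s D e \<Delta> \<longleftrightarrow> full \<Delta> \<and> above \<Gamma> \<Delta>
    \<and> (\<forall>t. \<forall>F \<in> K t. dv (\<Delta> t) (\<^bold>\<not> F) \<and> dv (\<Delta> t) (\<^bold>\<box> \<^bold>\<not> F))
    \<and> dv (\<Delta> s) (\<^bold>\<box> \<^bold>\<not> D) \<and> (e \<or> dv (\<Delta> s) (\<^bold>\<not> D))"

definition saturated :: "(bool \<Rightarrow> fm set) \<Rightarrow> (bool \<Rightarrow> fm set) \<Rightarrow> bool \<Rightarrow> fm \<Rightarrow> bool"
  where "saturated \<Gamma> K s D \<longleftrightarrow> (\<forall>t F G. F \<^bold>\<rhd> G \<in> \<Phi> t \<longrightarrow> dv (\<Gamma> t) (F \<^bold>\<rhd> G) \<longrightarrow>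
    F \<in> K t \<or> (\<exists>\<Delta>. succ \<Gamma> K s D False \<Delta> \<and> dv (\<Delta> t) G))"

lemma succ_exists:
  assumes "insep V \<Delta>" "\<And>u. unbox (\<Gamma> u) \<union> never (L u) \<subseteq> \<Delta> u"
    and "dv (\<Delta> s) (\<^bold>\<box> \<^bold>\<not> D)" "e \<or> dv (\<Delta> s) (\<^bold>\<not> D)"
    and "dv (\<Delta> t) (last_sat G)" "\<^bold>\<not> G \<in> goals t"
  shows "\<exists>\<Delta>. succ \<Gamma> (\<lambda>u. set (L u)) s D e \<Delta> \<and> dv (\<Delta> t) G"
proof -
  obtain \<Theta> where \<Theta>: "full \<Theta>" "\<And>u. \<Delta> u \<subseteq> \<Theta> u"
    using full_extend[OF assms(1)] by blast
  have mono: "dv (\<Theta> u) A" if "dv (\<Delta> u) A" for u A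
    using that \<Theta>(2) by (rule dv_mono)
  have hyp: "dv (\<Theta> u) A" if "A \<in> unbox (\<Gamma> u) \<union> never (L u)" for u A
    using that assms(2) \<Theta>(2) by (blast intro: dv.hyp)
  have G: "dv (\<Theta> t) G" "dv (\<Theta> t) (\<^bold>\<box> \<^bold>\<not> G)"
    using mono[OF assms(5)] by (rule dv_taut1, simp add: tautology_def)+
  have "\<not> dv (\<Gamma> t) (\<^bold>\<box> \<^bold>\<not> G)"
  proof
    assume "dv (\<Gamma> t) (\<^bold>\<box> \<^bold>\<not> G)"
    then have "dv (\<Theta> t) (\<^bold>\<not> G)" by (intro hyp) (simp add: unbox_def)
    then show False using \<Theta>(1) G(1) insep_consistent unfolding full_def by blast
  qed
  then have "above \<Gamma> \<Theta>"
    using G(2) assms(6) hyp unfolding above_def unbox_def by blast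
  moreover have "dv (\<Theta> u) (\<^bold>\<not> F) \<and> dv (\<Theta> u) (\<^bold>\<box> \<^bold>\<not> F)" if "F \<in> set (L u)" for u F
    using that by (auto intro!: hyp simp: never_def)
  ultimately have "succ \<Gamma> (\<lambda>u. set (L u)) s D e \<Theta>"
    unfolding succ_def using \<Theta>(1) assms(3,4) mono by auto
  with G(1) show ?thesis by blast
qed

lemma avoid_saturated:
  assumes "avoid V (\<Gamma> s) (\<Gamma> (\<not> s)) D (L s) (L (\<not> s))"
  shows "\<exists>L. avoid V (\<Gamma> s) (\<Gamma> (\<not> s)) D (L s) (L (\<not> s)) \<and> saturated \<Gamma> (\<lambda>u. set (L u)) s D"
  using assms
proof (induction "\<Sum>u\<in>UNIV. card (\<Phi> u - set (L u))" arbitrary: L rule: less_induct)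
  case less
  show ?case
  proof (cases "saturated \<Gamma> (\<lambda>u. set (L u)) s D")
    case True
    with less.prems show ?thesis by blast
  next
    case False
    then obtain t F G where FG: "F \<^bold>\<rhd> G \<in> \<Phi> t" "dv (\<Gamma> t) (F \<^bold>\<rhd> G)" "F \<notin> set (L t)"
      "\<not> (\<exists>\<Delta>. succ \<Gamma> (\<lambda>u. set (L u)) s D False \<Delta> \<and> dv (\<Delta> t) G)"
      unfolding saturated_def by blast
    define \<Delta> where "\<Delta> u = unbox (\<Gamma> u) \<union> never (if u = s then L u @ [D] else L u)" for u
    define \<Delta>' where "\<Delta>' = \<Delta>(t := insert (last_sat G) (\<Delta> t))"
    have \<Delta>': "\<Delta> u \<subseteq> \<Delta>' u" for u unfolding \<Delta>'_def by auto
    have "\<not> insep V \<Delta>'"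
    proof
      assume ins: "insep V \<Delta>'"
      have "\<exists>\<Delta>. succ \<Gamma> (\<lambda>u. set (L u)) s D False \<Delta> \<and> dv (\<Delta> t) G"
      proof (rule succ_exists[OF ins])
        show "unbox (\<Gamma> u) \<union> never (L u) \<subseteq> \<Delta>' u" for u
          using \<Delta>'[of u] unfolding \<Delta>_def never_def by (auto split: if_splits)
        have "{\<^bold>\<not> D, \<^bold>\<box> \<^bold>\<not> D} \<subseteq> \<Delta>' s"
          using \<Delta>'[of s] unfolding \<Delta>_def never_def by auto
        then show "dv (\<Delta>' s) (\<^bold>\<box> \<^bold>\<not> D)" "False \<or> dv (\<Delta>' s) (\<^bold>\<not> D)"
          by (auto intro: dv.hyp)
        show "dv (\<Delta>' t) (last_sat G)" unfolding \<Delta>'_def by (simp add: dv.hyp)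
        show "\<^bold>\<not> G \<in> goals t" using FG(1) \<Phi>_Rhd unfolding goals_def by blast
      qed
      with FG(4) show False by blast
    qed
    then obtain J where J: "vars J \<subseteq> V" "dv (\<Delta>' t) J" "dv (\<Delta>' (\<not> t)) (\<^bold>\<not> J)"
      by (rule not_insepE)
    let ?L = "L(t := F # L t)"
    have av: "avoid V (\<Gamma> s) (\<Gamma> (\<not> s)) D (?L s) (?L (\<not> s))"
    proof (cases "t = s")
      case True
      then have "avoid V (\<Gamma> s) (\<Gamma> (\<not> s)) D (F # L s) (L (\<not> s))"
        using J FG(2) unfolding \<Delta>'_def \<Delta>_def
        by (intro avoid_Cons_left[OF less.prems, of F G J]) simp_all
      with True show ?thesis by simp
    next
      case False
      then have t: "t = (\<not> s)" by auto
      then have "avoid V (\<Gamma> s) (\<Gamma> (\<not> s)) D (L s) (F # L (\<not> s))"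
        using J FG(2) unfolding \<Delta>'_def \<Delta>_def
        by (intro avoid_Cons_right[OF less.prems, of F G J]) simp_all
      with t show ?thesis by simp
    qed
    have "(\<Sum>u\<in>UNIV. card (\<Phi> u - set (?L u))) < (\<Sum>u\<in>UNIV. card (\<Phi> u - set (L u)))"
    proof (rule sum_strict_mono_ex1)
      show "\<forall>u\<in>UNIV. card (\<Phi> u - set (?L u)) \<le> card (\<Phi> u - set (L u))"
        by (intro ballI card_mono finite_Diff finite_\<Phi>) auto
      have "\<Phi> t - set (?L t) \<subset> \<Phi> t - set (L t)"
        using FG(3) \<Phi>_Rhd[OF FG(1)] by auto
      then show "\<exists>u\<in>UNIV. card (\<Phi> u - set (?L u)) < card (\<Phi> u - set (L u))"
        using psubset_card_mono[OF finite_Diff[OF finite_\<Phi>]] by blast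
    qed simp
    then show ?thesis using av by (rule less.hyps)
  qed
qed

lemma class_exists:
  assumes "full \<Gamma>" "dv (\<Gamma> s) (\<^bold>\<not> (C \<^bold>\<rhd> D))" "\<^bold>\<not> C \<in> goals s"
  shows "\<exists>K \<Delta>. saturated \<Gamma> K s D \<and> succ \<Gamma> K s D True \<Delta> \<and> dv (\<Delta> s) C"
proof -
  obtain L where L: "avoid V (\<Gamma> s) (\<Gamma> (\<not> s)) D (L s) (L (\<not> s))"
    "saturated \<Gamma> (\<lambda>u. set (L u)) s D"
    using avoid_saturated[of \<Gamma> s D "\<lambda>_. []"] avoid_Nil by blast
  define \<Delta> where "\<Delta> u = unbox (\<Gamma> u) \<union> never (L u)" for u
  define \<Delta>' where "\<Delta>' = \<Delta>(s := insert (last_sat C \<^bold>\<and> \<^bold>\<box> \<^bold>\<not> D) (\<Delta> s))"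
  have ins: "insep V \<Delta>'"
  proof (rule ccontr)
    assume "\<not> insep V \<Delta>'"
    then obtain J where "vars J \<subseteq> V" "dv (\<Delta>' s) J" "dv (\<Delta>' (\<not> s)) (\<^bold>\<not> J)"
      by (rule not_insepE)
    then have "\<exists>I. vars I \<subseteq> V \<and> dv (\<Gamma> s) (\<^bold>\<not> I) \<and> dv (\<Gamma> (\<not> s)) I"
      unfolding \<Delta>'_def \<Delta>_def by (intro avoid_separable[OF L(1) assms(2)]) auto
    then show False using assms(1) insepD[of V \<Gamma> _ "\<not> s"] unfolding full_def by auto
  qed
  have "dv (\<Delta>' s) (last_sat C \<^bold>\<and> \<^bold>\<box> \<^bold>\<not> D)"
    unfolding \<Delta>'_def by (simp add: dv.hyp)
  then have "dv (\<Delta>' s) (last_sat C)" "dv (\<Delta>' s) (\<^bold>\<box> \<^bold>\<not> D)"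
    by (rule dv_taut1, simp add: tautology_def)+
  moreover have "unbox (\<Gamma> u) \<union> never (L u) \<subseteq> \<Delta>' u" for u
    unfolding \<Delta>'_def \<Delta>_def by auto
  ultimately show ?thesis
    using succ_exists[OF ins, of \<Gamma> L s D True s C] assms(3) L(2) by auto
qed

text \<open>A world is the path leading to it from the root; a step records the pair reached, the class of
  the step, and whether it leads to the entry of the class.\<close>

type_synonym step = "(bool \<Rightarrow> fm set) \<times> ((bool \<Rightarrow> fm set) \<times> bool \<times> fm) \<times> bool"

fun path :: "(bool \<Rightarrow> fm set) \<Rightarrow> step list \<Rightarrow> bool" where
  "path \<Gamma> [] \<longleftrightarrow> True"
| "path \<Gamma> ((\<Delta>, (K, s, D), e) # l) \<longleftrightarrow> saturated \<Gamma> K s D \<and> succ \<Gamma> K s D e \<Delta> \<and> path \<Delta> l"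

fun tip :: "(bool \<Rightarrow> fm set) \<Rightarrow> step list \<Rightarrow> bool \<Rightarrow> fm set" where
  "tip \<Gamma> [] = \<Gamma>"
| "tip \<Gamma> ((\<Delta>, _) # l) = tip \<Delta> l"

lemma tip_append: "tip \<Gamma> (l @ m) = tip (tip \<Gamma> l) m"
  by (induction \<Gamma> l rule: tip.induct) auto

lemma path_append: "path \<Gamma> (l @ m) \<longleftrightarrow> path \<Gamma> l \<and> path (tip \<Gamma> l) m"
  by (induction \<Gamma> l rule: path.induct) auto

lemma full_tip: "full \<Gamma> \<Longrightarrow> path \<Gamma> l \<Longrightarrow> full (tip \<Gamma> l)"
  by (induction \<Gamma> l rule: path.induct) (auto simp: succ_def)

lemma above_tip: "path \<Gamma> l \<Longrightarrow> l \<noteq> [] \<Longrightarrow> above \<Gamma> (tip \<Gamma> l)"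
proof (induction \<Gamma> l rule: path.induct)
  case (2 \<Gamma> \<Delta> K s D e l)
  then have "above \<Gamma> \<Delta>" by (simp add: succ_def)
  with 2 show ?case by (cases "l = []") (auto intro: above_trans)
qed simp

lemma box_tip:
  assumes "path \<Gamma> l" "dv (\<Gamma> s) A" "dv (\<Gamma> s) (\<^bold>\<box> A)"
  shows "dv (tip \<Gamma> l s) A"
  using assms above_tip unfolding above_def by (cases "l = []") auto

context
  fixes \<Gamma>0 :: "bool \<Rightarrow> fm set"
  assumes full_\<Gamma>0: "full \<Gamma>0"
begin

definition acc :: "step list \<Rightarrow> step list \<Rightarrow> bool"
  where "acc x y \<longleftrightarrow> path \<Gamma>0 y \<and> (\<exists>a m. y = x @ a # m)"

definition vis :: "step list \<Rightarrow> step list \<Rightarrow> step list \<Rightarrow> bool"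
  where "vis x y z \<longleftrightarrow> path \<Gamma>0 y \<and> path \<Gamma>0 z \<and> (\<exists>\<Delta> c e m \<Delta>' e' m'. y = x @ (\<Delta>, c, e) # m
    \<and> z = x @ (\<Delta>', c, e') # m' \<and> (m' \<noteq> [] \<or> \<not> e'))"

definition val :: "step list \<Rightarrow> nat \<Rightarrow> bool"
  where "val x p \<longleftrightarrow> (\<exists>s. Var p \<in> \<Phi> s \<and> dv (tip \<Gamma>0 x s) (Var p))"

lemma acc_trans: "acc x y \<Longrightarrow> acc y z \<Longrightarrow> acc x z"
  unfolding acc_def by auto

lemma acc_wf: "wfP (\<lambda>y x. acc x y)"
proof (rule wfp_if_convertible_to_nat)
  fix y x assume "acc x y"
  then obtain a m where "y = x @ a # m" "path \<Gamma>0 y" unfolding acc_def by blast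
  then have "above (tip \<Gamma>0 x) (tip \<Gamma>0 y)"
    using above_tip[of "tip \<Gamma>0 x" "a # m"] by (simp add: tip_append path_append)
  then show "rank (tip \<Gamma>0 y) < rank (tip \<Gamma>0 x)" by (rule above_rank)
qed

lemma vis_acc: "vis x y z \<Longrightarrow> acc x z"
  unfolding vis_def acc_def by blast

lemma vis_trans: "vis x y z \<Longrightarrow> vis x z w \<Longrightarrow> vis x y w"
  unfolding vis_def by auto

lemma acc_vis:
  assumes "acc x y" "acc y z"
  shows "vis x y z"
proof -
  obtain \<Delta> K s D e m where "y = x @ (\<Delta>, (K, s, D), e) # m" "path \<Gamma>0 y"
    using assms(1) unfolding acc_def by auto
  moreover obtain b n where "z = y @ b # n" "path \<Gamma>0 z"
    using assms(2) unfolding acc_def by blast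
  ultimately show ?thesis unfolding vis_def by auto
qed

abbreviation sat :: "step list \<Rightarrow> fm \<Rightarrow> bool"
  where "sat \<equiv> holds val acc vis"

lemma truth: "path \<Gamma>0 x \<Longrightarrow> A \<in> \<Phi> s \<Longrightarrow> sat x A \<longleftrightarrow> dv (tip \<Gamma>0 x s) A"
proof (induction A arbitrary: x s)
  case Bot
  have "full (tip \<Gamma>0 x)" using full_\<Gamma>0 Bot(1) by (rule full_tip)
  moreover have "dv (tip \<Gamma>0 x s) (\<^bold>\<not> \<^bold>\<bottom>)" by (rule dv_taut) (simp add: tautology_def)
  ultimately show ?case using full_Neg_iff Bot(2) by auto
next
  case (Var p)
  have full: "full (tip \<Gamma>0 x)" using full_\<Gamma>0 Var(1) by (rule full_tip)
  have "dv (tip \<Gamma>0 x s) (Var p)" if t: "Var p \<in> \<Phi> t" "dv (tip \<Gamma>0 x t) (Var p)" for t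
  proof (rule ccontr)
    assume *: "\<not> dv (tip \<Gamma>0 x s) (Var p)"
    have "t \<noteq> s"
    proof
      assume "t = s"
      with t(2) * show False by simp
    qed
    then have s: "s = (\<not> t)" by auto
    then have "p \<in> V" using common t(1) Var(2) by (cases t) auto
    moreover have "dv (tip \<Gamma>0 x (\<not> t)) (\<^bold>\<not> Var p)"
      using full_Neg_iff[OF full Var(2)] * s by simp
    ultimately show False
      using insepD[of V "tip \<Gamma>0 x" "Var p" t] t(2) full unfolding full_def by simp
  qed
  then show ?case using Var(2) by (auto simp: val_def)
next
  case (Imp A B)
  have full: "full (tip \<Gamma>0 x)" using full_\<Gamma>0 Imp.prems(1) by (rule full_tip)
  have AB: "A \<in> \<Phi> s" "B \<in> \<Phi> s" using \<Phi>_Imp Imp.prems(2) by blast+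
  have "dv (tip \<Gamma>0 x s) (A \<^bold>\<longrightarrow> B) \<longleftrightarrow> dv (tip \<Gamma>0 x s) (\<^bold>\<not> A) \<or> dv (tip \<Gamma>0 x s) B"
  proof
    assume "dv (tip \<Gamma>0 x s) (A \<^bold>\<longrightarrow> B)"
    then show "dv (tip \<Gamma>0 x s) (\<^bold>\<not> A) \<or> dv (tip \<Gamma>0 x s) B"
      using full_Neg_iff[OF full AB(1)] by (blast intro: dv.mp)
  next
    assume "dv (tip \<Gamma>0 x s) (\<^bold>\<not> A) \<or> dv (tip \<Gamma>0 x s) B"
    then show "dv (tip \<Gamma>0 x s) (A \<^bold>\<longrightarrow> B)"
      by (auto elim!: dv_taut1 simp: tautology_def)
  qed
  then show ?case
    using full_Neg_iff[OF full AB(1)] Imp.IH(1)[OF Imp.prems(1) AB(1)]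
      Imp.IH(2)[OF Imp.prems(1) AB(2)] by simp
next
  case (Box A)
  have full: "full (tip \<Gamma>0 x)" using full_\<Gamma>0 Box.prems(1) by (rule full_tip)
  have A: "A \<in> \<Phi> s" using \<Phi>_Box Box.prems(2) by blast
  show ?case
  proof
    assume *: "sat x (\<^bold>\<box> A)"
    show "dv (tip \<Gamma>0 x s) (\<^bold>\<box> A)"
    proof (rule ccontr)
      assume "\<not> dv (tip \<Gamma>0 x s) (\<^bold>\<box> A)"
      then have "dv (tip \<Gamma>0 x s) (\<^bold>\<not> \<^bold>\<box> A)" using full_Neg_iff[OF full Box.prems(2)] by blast
      moreover have "dv (tip \<Gamma>0 x s) ((\<^bold>\<box> A) \<^bold>\<longleftrightarrow> ((\<^bold>\<not> A) \<^bold>\<rhd> \<^bold>\<bottom>))"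
        by (intro dv.base ILm.J6)
      ultimately have "dv (tip \<Gamma>0 x s) (\<^bold>\<not> ((\<^bold>\<not> A) \<^bold>\<rhd> \<^bold>\<bottom>))"
        by (rule dv_taut2) (auto simp: tautology_def)
      moreover have "\<^bold>\<not> \<^bold>\<not> A \<in> goals s" using A unfolding goals_def by blast
      ultimately obtain K \<Delta> where \<Delta>: "saturated (tip \<Gamma>0 x) K s \<^bold>\<bottom>"
        "succ (tip \<Gamma>0 x) K s \<^bold>\<bottom> True \<Delta>" "dv (\<Delta> s) (\<^bold>\<not> A)"
        using class_exists[OF full] by blast
      let ?y = "x @ [(\<Delta>, (K, s, \<^bold>\<bottom>), True)]"
      have y: "path \<Gamma>0 ?y" "tip \<Gamma>0 ?y = \<Delta>"
        using Box.prems(1) \<Delta> by (simp_all add: path_append tip_append)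
      have "acc x ?y" using y(1) unfolding acc_def by blast
      then have "sat ?y A" using * unfolding holds.simps(4) by blast
      then have "dv (\<Delta> s) A" using Box.IH[OF y(1) A] y(2) by simp
      then show False using \<Delta>(2,3) insep_consistent unfolding succ_def full_def by blast
    qed
  next
    assume *: "dv (tip \<Gamma>0 x s) (\<^bold>\<box> A)"
    show "sat x (\<^bold>\<box> A)"
    proof (simp, intro allI impI)
      fix y assume "acc x y"
      then obtain a m where y: "y = x @ a # m" "path \<Gamma>0 y" unfolding acc_def by blast
      then have "above (tip \<Gamma>0 x) (tip \<Gamma>0 y)"
        using above_tip[of "tip \<Gamma>0 x" "a # m"] by (simp add: tip_append path_append)
      then have "dv (tip \<Gamma>0 y s) A" using * unfolding above_def by blast
      then show "sat y A" using Box.IH[OF y(2) A] by blast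
    qed
  qed
next
  case (Rhd A B)
  have full: "full (tip \<Gamma>0 x)" using full_\<Gamma>0 Rhd.prems(1) by (rule full_tip)
  have AB: "A \<in> \<Phi> s" "B \<in> \<Phi> s" using \<Phi>_Rhd Rhd.prems(2) by blast+
  show ?case
  proof
    assume *: "sat x (A \<^bold>\<rhd> B)"
    show "dv (tip \<Gamma>0 x s) (A \<^bold>\<rhd> B)"
    proof (rule ccontr)
      assume "\<not> dv (tip \<Gamma>0 x s) (A \<^bold>\<rhd> B)"
      then have "dv (tip \<Gamma>0 x s) (\<^bold>\<not> (A \<^bold>\<rhd> B))" using full_Neg_iff[OF full Rhd.prems(2)] by blast
      moreover have "\<^bold>\<not> A \<in> goals s" using AB unfolding goals_def by blast
      ultimately obtain K \<Delta> where \<Delta>: "saturated (tip \<Gamma>0 x) K s B"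
        "succ (tip \<Gamma>0 x) K s B True \<Delta>" "dv (\<Delta> s) A"
        using class_exists[OF full] by blast
      let ?y = "x @ [(\<Delta>, (K, s, B), True)]"
      have y: "path \<Gamma>0 ?y" "tip \<Gamma>0 ?y = \<Delta>"
        using Rhd.prems(1) \<Delta> by (simp_all add: path_append tip_append)
      then have "sat ?y A" using Rhd.IH(1)[OF y(1) AB(1)] \<Delta>(3) by simp
      moreover have "acc x ?y" using y(1) unfolding acc_def by blast
      ultimately obtain z where z: "vis x ?y z" "sat z B"
        using * unfolding holds.simps(5) by blast
      then obtain \<Theta> e m where zx: "z = x @ (\<Theta>, (K, s, B), e) # m" and m: "m \<noteq> [] \<or> \<not> e"
        and pz: "path \<Gamma>0 z"
        unfolding vis_def by auto
      have \<Theta>: "succ (tip \<Gamma>0 x) K s B e \<Theta>" "path \<Theta> m" "tip \<Gamma>0 z = tip \<Theta> m"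
        using pz zx by (simp_all add: path_append tip_append)
      have "dv (tip \<Theta> m s) (\<^bold>\<not> B)"
      proof (cases "m = []")
        case True
        then show ?thesis using m \<Theta>(1) unfolding succ_def by auto
      next
        case False
        then show ?thesis using above_tip[OF \<Theta>(2)] \<Theta>(1) unfolding succ_def above_def by blast
      qed
      moreover have "dv (tip \<Theta> m s) B" using Rhd.IH(2)[OF pz AB(2)] z(2) \<Theta>(3) by simp
      moreover have "insep V (tip \<Theta> m)"
        using full_tip[OF full_\<Gamma>0 pz] \<Theta>(3) unfolding full_def by simp
      ultimately show False using insep_consistent by blast
    qed
  next
    assume *: "dv (tip \<Gamma>0 x s) (A \<^bold>\<rhd> B)"
    show "sat x (A \<^bold>\<rhd> B)"
    proof (simp, intro allI impI)
      fix y assume "acc x y" and y: "sat y A"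
      then obtain \<Delta> K t D e m where yx: "y = x @ (\<Delta>, (K, t, D), e) # m" and py: "path \<Gamma>0 y"
        unfolding acc_def by auto
      have \<Delta>: "saturated (tip \<Gamma>0 x) K t D" "succ (tip \<Gamma>0 x) K t D e \<Delta>" "path \<Delta> m"
        "tip \<Gamma>0 y = tip \<Delta> m"
        using py yx by (simp_all add: path_append tip_append)
      have A: "dv (tip \<Delta> m s) A" using Rhd.IH(1)[OF py AB(1)] y \<Delta>(4) by simp
      have "A \<notin> K s"
      proof
        assume "A \<in> K s"
        then have "dv (tip \<Delta> m s) (\<^bold>\<not> A)"
          using \<Delta>(2) by (intro box_tip[OF \<Delta>(3)]) (auto simp: succ_def)
        moreover have "insep V (tip \<Delta> m)"
          using full_tip[OF full_\<Gamma>0 py] \<Delta>(4) unfolding full_def by simp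
        ultimately show False using A insep_consistent by blast
      qed
      then obtain \<Theta> where \<Theta>: "succ (tip \<Gamma>0 x) K t D False \<Theta>" "dv (\<Theta> s) B"
        using \<Delta>(1) Rhd.prems(2) * unfolding saturated_def by blast
      let ?z = "x @ [(\<Theta>, (K, t, D), False)]"
      have z: "path \<Gamma>0 ?z" "tip \<Gamma>0 ?z = \<Theta>"
        using Rhd.prems(1) \<Delta>(1) \<Theta>(1) by (simp_all add: path_append tip_append)
      then have "sat ?z B" using Rhd.IH(2)[OF z(1) AB(2)] \<Theta>(2) by simp
      moreover have "vis x y ?z" unfolding vis_def using py z(1) yx by blast
      ultimately show "\<exists>z. vis x y z \<and> sat z B" by blast
    qed
  qed
qed

end

end

theorem theorem4p1:
  fixes A B :: fm
  assumes "ILm (J2_plus \<union> J5) (A \<^bold>\<longrightarrow> B)"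
  shows "\<exists>C. vars C \<subseteq> vars A \<inter> vars B
    \<and> ILm (J2_plus \<union> J5) (A \<^bold>\<longrightarrow> C)
    \<and> ILm (J2_plus \<union> J5) (C \<^bold>\<longrightarrow> B)"
proof (rule ccontr)
  assume no: "\<not> ?thesis"
  define \<Phi> where "\<Phi> s = subs (if s then A else \<^bold>\<not> B)" for s
  interpret interpolation "vars A \<inter> vars B" \<Phi>
  proof
    show "finite (\<Phi> s)" for s unfolding \<Phi>_def by (rule finite_subs)
    show "subs C \<subseteq> \<Phi> s" if "C \<in> \<Phi> s" for C s
      using that unfolding \<Phi>_def by (rule subs_trans)
    show "p \<in> vars A \<inter> vars B" if "Var p \<in> \<Phi> True" "Var p \<in> \<Phi> False" for p
      using that[unfolded \<Phi>_def, THEN vars_subs] by simp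
  qed
  have "insep (vars A \<inter> vars B) (\<lambda>s. {if s then A else \<^bold>\<not> B})"
    unfolding insep_def
  proof (rule notI, elim exE conjE)
    fix I
    assume I: "vars I \<subseteq> vars A \<inter> vars B" "dv {if True then A else \<^bold>\<not> B} I"
      "dv {if False then A else \<^bold>\<not> B} (\<^bold>\<not> I)"
    have "dv {} (A \<^bold>\<longrightarrow> I)" "dv {} (\<^bold>\<not> B \<^bold>\<longrightarrow> \<^bold>\<not> I)"
      using I(2,3) by (simp_all add: dv_insert_iff)
    moreover from this(2) have "dv {} (I \<^bold>\<longrightarrow> B)"
      by (rule dv_taut1) (auto simp: tautology_def)
    ultimately show False using no I(1) dv_empty by blast
  qed
  from full_extend[OF this] obtain \<Gamma>
    where \<Gamma>: "full \<Gamma>" "\<And>s. (if s then A else \<^bold>\<not> B) \<in> \<Gamma> s"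
    by (auto simp only: insert_subset)
  have "holds (val \<Gamma>) (acc \<Gamma>) (vis \<Gamma>) [] (if s then A else \<^bold>\<not> B)" for s
  proof (subst truth[OF \<Gamma>(1)])
    show "(if s then A else \<^bold>\<not> B) \<in> \<Phi> s" unfolding \<Phi>_def by (rule subs_refl)
    show "dv (tip \<Gamma> [] s) (if s then A else \<^bold>\<not> B)" using \<Gamma>(2) by (simp only: tip.simps dv.hyp)
  qed simp
  from this[of True] this[of False]
  have "\<not> holds (val \<Gamma>) (acc \<Gamma>) (vis \<Gamma>) [] (A \<^bold>\<longrightarrow> B)" by simp
  moreover have "holds (val \<Gamma>) (acc \<Gamma>) (vis \<Gamma>) [] (A \<^bold>\<longrightarrow> B)"
    using assms acc_trans[OF \<Gamma>(1)] acc_wf[OF \<Gamma>(1)] vis_acc[OF \<Gamma>(1)] vis_trans[OF \<Gamma>(1)] acc_vis[OF \<Gamma>(1)]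
    by (rule soundness)
  ultimately show False by blast
qed

end
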